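(* The natural map from parabolic $\mathbb Q$-lattices to $\mathbb Q$-lattices up to scale $$\theta:\ \Pi=P^+(\mathbb Z)\backslash\big(\overline{P(\hat{\mathbb Z})}\times P^+(\mathbb R)\big)\longrightarrow\Gamma\backslash\big(M_2(\hat{\mathbb Z})\times GL_2^+(\mathbb R)\big)/\mathbb C^\times,\qquad\Gamma=SL_2(\mathbb Z),$$ is holomorphic for the canonical complex structure on the moduli space of elliptic curves (on the target) and the complex structure on $\Pi$ associated to the right action of $P^+(\mathbb R)$.
   Context: For a commutative ring $R$, $\overline{P(R)}=\left\{\begin{pmatrix} a&b\\0&1\end{pmatrix}: a,b\in R\right\}\subset M_2(R)$, $P(R)$ is the group of those matrices with $a$ invertible, and for a subring $R$ of $\mathbb R$, $P^+(R)$ is the subgroup of $P(R)$ with $a>0$. $P^+(\mathbb Z)$ and $\Gamma$ act diagonally by left multiplication; $\mathbb C^\times\subset GL_2^+(\mathbb R)$ via $a+ib\mapsto\begin{pmatrix} a&b\\-b&a\end{pmatrix}$ acts by right multiplication on $GL_2^+(\mathbb R)$. The map $\theta$ is induced by the inclusions $\overline{P(\hat{\mathbb Z})}\subset M_2(\hat{\mathbb Z})$ and $P^+(\mathbb R)\subset GL_2^+(\mathbb R)$. The canonical complex structure on the target is the one coming from the identification $GL_2^+(\mathbb R)/\mathbb C^\times\simeq\mathbb H$, $\alpha=\begin{pmatrix} a&b\\c&d\end{pmatrix}\mapsto\alpha(i)=\frac{ai+b}{ci+d}$, with local parameter $z\in\mathbb H$. The complex structure on $\Pi$ associated to the right action of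 $P^+(\mathbb R)$ on the $P^+(\mathbb R)$ factor is the one for which a function $f$ is holomorphic iff $(X+iY)f=0$, where in the coordinates $\begin{pmatrix} y&x\\0&1\end{pmatrix}\in P^+(\mathbb R)$ the vector fields generating right multiplication by $\begin{pmatrix}1&\epsilon\\0&1\end{pmatrix}$ and $\begin{pmatrix}e^\epsilon&0\\0&1\end{pmatrix}$ are $X=y\partial_x$ and $Y=y\partial_y$ respectively. Complex structures are along the archimedean directions, the non-archimedean components being locally fixed. *)

theory Defs
  imports "HOL-Analysis.Analysis"
begin

section \<open>The profinite integers\<close>

text \<open>The inverse limit of the rings \<open>\<int>/n\<close> (\<open>n > 0\<close>), each residue class being represented by
  its least non-negative element (the case \<open>m = n\<close> of the condition says \<open>0 \<le> z n < n\<close>).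
  The modulus \<open>0\<close> does not belong to the limit; that component is fixed to be \<open>0\<close>.\<close>

typedef zhat = "{z :: nat \<Rightarrow> int. z 0 = 0 \<and> (\<forall>m n. 0 < n \<longrightarrow> m dvd n \<longrightarrow> z n mod int m = z m)}"
  by (rule exI[of _ "\<lambda>_. 0"]) simp

setup_lifting type_definition_zhat

instantiation zhat :: comm_ring_1
begin

lift_definition zero_zhat :: zhat is "\<lambda>_. 0"
  by simp

lift_definition one_zhat :: zhat is "\<lambda>n. if n = 0 then 0 else 1 mod int n"
  by (auto simp: mod_mod_cancel)

lift_definition plus_zhat :: "zhat \<Rightarrow> zhat \<Rightarrow> zhat" is "\<lambda>z w n. (z n + w n) mod int n"
  by (simp add: mod_mod_cancel) (metis mod_add_eq)

lift_definition times_zhat :: "zhat \<Rightarrow> zhat \<Rightarrow> zhat" is "\<lambda>z w n. (z n * w n) mod int n"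
  by (simp add: mod_mod_cancel) (metis mod_mult_eq)

lift_definition uminus_zhat :: "zhat \<Rightarrow> zhat" is "\<lambda>z n. (- z n) mod int n"
  by (simp add: mod_mod_cancel) (metis mod_minus_eq)

lift_definition minus_zhat :: "zhat \<Rightarrow> zhat \<Rightarrow> zhat" is "\<lambda>z w n. (z n - w n) mod int n"
  by (simp add: mod_mod_cancel) (metis mod_diff_eq)

instance
proof
  fix a b c :: zhat
  have red: "z n mod int n = z n"
    if "z 0 = 0 \<and> (\<forall>m n. 0 < n \<longrightarrow> m dvd n \<longrightarrow> z n mod int m = z m)" for z :: "nat \<Rightarrow> int" and n
    using that by (cases "n = 0") auto
  show "a * b * c = a * (b * c)"
    by transfer (auto simp: mod_simps ac_simps)
  show "a * b = b * a"
    by transfer (auto simp: ac_simps)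
  show "1 * a = a"
    by transfer (auto simp: fun_eq_iff mod_simps red)
  show "a + b + c = a + (b + c)"
    by transfer (auto simp: mod_simps ac_simps)
  show "a + b = b + a"
    by transfer (auto simp: ac_simps)
  show "0 + a = a"
    by transfer (auto simp: fun_eq_iff red)
  show "- a + a = 0"
    by transfer (auto simp: mod_simps)
  show "a - b = a + - b"
    by transfer (auto simp: mod_simps)
  show "(a + b) * c = a * c + b * c"
    by transfer (auto simp: mod_simps algebra_simps)
  show "(0 :: zhat) \<noteq> 1"
    by transfer (auto simp: fun_eq_iff intro!: exI[of _ 2])
qed

end

text \<open>The profinite topology: the subspace topology of the product of the discrete spaces \<open>\<int>\<close>.\<close>

instantiation zhat :: topological_space
begin

definition open_zhat :: "zhat set \<Rightarrow> bool" where
  "open_zhat U \<longleftrightarrow> (\<exists>V. open V \<and> U = Rep_zhat -` V)"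

instance
proof
  show "open (UNIV :: zhat set)"
    unfolding open_zhat_def by (rule exI[of _ UNIV]) auto
next
  fix S T :: "zhat set"
  assume "open S" "open T"
  then show "open (S \<inter> T)"
    unfolding open_zhat_def by (metis open_Int vimage_Int)
next
  fix K :: "zhat set set"
  assume "\<forall>S\<in>K. open S"
  then obtain V where V: "\<And>S. S \<in> K \<Longrightarrow> open (V S) \<and> S = Rep_zhat -` V S"
    unfolding open_zhat_def by metis
  then have "open (\<Union>S\<in>K. V S)" "\<Union>K = Rep_zhat -` (\<Union>S\<in>K. V S)"
    by blast+
  then show "open (\<Union>K)"
    unfolding open_zhat_def by blast
qed

end


section \<open>Matrix groups and semigroups\<close>

definition mat2 :: "'a \<Rightarrow> 'a \<Rightarrow> 'a \<Rightarrow> 'a \<Rightarrow> 'a::zero ^ 2 ^ 2" where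
  "mat2 a b c d = vector [vector [a, b], vector [c, d]]"

definition Pbar :: "('a::comm_ring_1 ^ 2 ^ 2) set" where
  "Pbar = {mat2 a b 0 1 | a b. True}"

definition Pgroup :: "('a::comm_ring_1 ^ 2 ^ 2) set" where
  "Pgroup = {mat2 a b 0 1 | a b. a dvd 1}"

definition Pplus :: "('a::linordered_idom ^ 2 ^ 2) set" where
  "Pplus = {A \<in> Pgroup. 0 < A $ 1 $ 1}"

definition SL2Z :: "(int ^ 2 ^ 2) set" where
  "SL2Z = {A. det A = 1}"

definition GL2plus :: "(real ^ 2 ^ 2) set" where
  "GL2plus = {A. 0 < det A}"

definition embed_complex :: "complex \<Rightarrow> real ^ 2 ^ 2" where
  "embed_complex w = mat2 (Re w) (Im w) (- Im w) (Re w)"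

text \<open>Integral matrices act through the ring homomorphisms \<open>\<int> \<rightarrow> zhat\<close> and \<open>\<int> \<rightarrow> \<real>\<close>.\<close>

type_synonym adelic_pair = "(zhat ^ 2 ^ 2) \<times> (real ^ 2 ^ 2)"

definition diag_act :: "int ^ 2 ^ 2 \<Rightarrow> adelic_pair \<Rightarrow> adelic_pair" where
  "diag_act A p = (map_matrix of_int A ** fst p, map_matrix of_int A ** snd p)"


section \<open>Quotient spaces\<close>

definition quotient_top :: "'a topology \<Rightarrow> ('a \<times> 'a) set \<Rightarrow> 'a set topology" where
  "quotient_top T r = topology (\<lambda>U. U \<subseteq> topspace T // r \<and> openin T (\<Union>U))"

lemma openin_quotient_top:
  assumes "equiv (topspace T) r"
  shows "openin (quotient_top T r) U \<longleftrightarrow> U \<subseteq> topspace T // r \<and> openin T (\<Union>U)"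
proof -
  have "istopology (\<lambda>U. U \<subseteq> topspace T // r \<and> openin T (\<Union>U))"
    unfolding istopology_def
  proof (intro conjI allI impI)
    fix U V
    assume U: "U \<subseteq> topspace T // r \<and> openin T (\<Union>U)" and V: "V \<subseteq> topspace T // r \<and> openin T (\<Union>V)"
    then show "U \<inter> V \<subseteq> topspace T // r"
      by blast
    have "\<Union>(U \<inter> V) = \<Union>U \<inter> \<Union>V"
      using U V quotient_disj[OF assms] by blast
    with U V show "openin T (\<Union>(U \<inter> V))"
      by (simp add: openin_Int)
  next
    fix K
    assume K: "\<forall>U\<in>K. U \<subseteq> topspace T // r \<and> openin T (\<Union>U)"
    then show "\<Union>K \<subseteq> topspace T // r"
      by blast
    have "\<Union>(\<Union>K) = (\<Union>U\<in>K. \<Union>U)"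
      by blast
    with K show "openin T (\<Union>(\<Union>K))"
      by (metis (no_types, lifting) image_iff openin_Union)
  qed
  then show ?thesis
    by (simp add: quotient_top_def topology_inverse')
qed

definition par_space :: "adelic_pair set" where
  "par_space = Pbar \<times> Pplus"

definition par_rel :: "(adelic_pair \<times> adelic_pair) set" where
  "par_rel = {(p, q). p \<in> par_space \<and> q \<in> par_space \<and> (\<exists>A\<in>Pplus. q = diag_act A p)}"

definition lat_space :: "adelic_pair set" where
  "lat_space = UNIV \<times> GL2plus"

definition lat_rel :: "(adelic_pair \<times> adelic_pair) set" where
  "lat_rel = {(p, q). p \<in> lat_space \<and> q \<in> lat_space \<and>
     (\<exists>A\<in>SL2Z. \<exists>w. w \<noteq> 0 \<and>
        q = (fst (diag_act A p), snd (diag_act A p) ** embed_complex w))}"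

lemma mat2_nth [simp]:
  "mat2 a b c d $ 1 $ 1 = a" "mat2 a b c d $ 1 $ 2 = b"
  "mat2 a b c d $ 2 $ 1 = c" "mat2 a b c d $ 2 $ 2 = d"
  by (simp_all add: mat2_def)

lemma mat2_eqI:
  "A $ 1 $ 1 = B $ 1 $ 1 \<Longrightarrow> A $ 1 $ 2 = B $ 1 $ 2 \<Longrightarrow> A $ 2 $ 1 = B $ 2 $ 1 \<Longrightarrow>
     A $ 2 $ 2 = B $ 2 $ 2 \<Longrightarrow> A = (B :: 'a ^ 2 ^ 2)"
  by (simp add: vec_eq_iff forall_2)

lemma matmul2_nth:
  fixes A B :: "'a::semiring_1 ^ 2 ^ 2"
  shows "(A ** B) $ i $ j = A $ i $ 1 * B $ 1 $ j + A $ i $ 2 * B $ 2 $ j"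
  by (simp add: matrix_matrix_mult_def sum_2)

lemma map_matrix_nth: "map_matrix f A $ i $ j = f (A $ i $ j)"
  by (simp add: map_matrix_def)

lemma Pplus_real: "(g :: real ^ 2 ^ 2) \<in> Pplus \<longleftrightarrow> (\<exists>x y. 0 < y \<and> g = mat2 y x 0 1)"
  by (force simp: Pplus_def Pgroup_def dvd_field_iff)

lemma Pplus_int: "(g :: int ^ 2 ^ 2) \<in> Pplus \<longleftrightarrow> (\<exists>x. g = mat2 1 x 0 1)"
  by (force simp: Pplus_def Pgroup_def zdvd1_eq)

lemma map_matrix_of_int_mult:
  fixes A B :: "int ^ 2 ^ 2"
  shows "map_matrix of_int (A ** B) =
     (map_matrix of_int A ** map_matrix of_int B :: 'a::comm_ring_1 ^ 2 ^ 2)"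
  by (rule mat2_eqI) (simp_all add: map_matrix_nth matmul2_nth)

lemma map_matrix_of_int_one: "map_matrix of_int (mat 1 :: int ^ 2 ^ 2) = (mat 1 :: 'a::comm_ring_1 ^ 2 ^ 2)"
  by (rule mat2_eqI) (simp_all add: map_matrix_nth mat_def)

lemma diag_act_mult: "diag_act (A ** B) p = diag_act A (diag_act B p)"
  by (simp add: diag_act_def map_matrix_of_int_mult matrix_mul_assoc)

lemma diag_act_one: "diag_act (mat 1) p = p"
  by (simp add: diag_act_def map_matrix_of_int_one matrix_mul_lid)

lemma mat2_int_inverse:
  fixes A :: "int ^ 2 ^ 2"
  assumes "det A = 1"
  shows "mat2 (A $ 2 $ 2) (- A $ 1 $ 2) (- A $ 2 $ 1) (A $ 1 $ 1) ** A = mat 1"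
  using assms by (intro mat2_eqI) (simp_all add: matmul2_nth mat_def det_2 algebra_simps)

lemma equiv_par_rel: "equiv par_space par_rel"
proof (rule equivI)
  show "par_rel \<subseteq> par_space \<times> par_space"
    by (auto simp: par_rel_def)
  have one: "mat 1 \<in> (Pplus :: (int ^ 2 ^ 2) set)"
    unfolding Pplus_int by (rule exI[of _ 0], rule mat2_eqI) (simp_all add: mat_def)
  show "refl_on par_space par_rel"
    unfolding refl_on_def
  proof
    fix p assume "p \<in> par_space"
    then show "(p, p) \<in> par_rel"
      unfolding par_rel_def using one diag_act_one[of p] by (auto intro!: bexI[of _ "mat 1"])
  qed
  show "sym par_rel"
  proof (rule symI)
    fix p q assume pq: "(p, q) \<in> par_rel"
    then obtain A where A: "A \<in> Pplus" "q = diag_act A p"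
      by (auto simp: par_rel_def)
    define B where "B = mat2 (A $ 2 $ 2) (- A $ 1 $ 2) (- A $ 2 $ 1) (A $ 1 $ 1)"
    have "B \<in> Pplus" "det A = 1"
      using A(1) by (auto simp: Pplus_int B_def det_2)
    moreover have "p = diag_act B q"
      using mat2_int_inverse[OF \<open>det A = 1\<close>] A(2)
      by (simp flip: diag_act_mult add: B_def diag_act_one)
    ultimately show "(q, p) \<in> par_rel"
      using pq by (auto simp: par_rel_def)
  qed
  show "trans par_rel"
  proof (rule transI)
    fix p q r assume pq: "(p, q) \<in> par_rel" and qr: "(q, r) \<in> par_rel"
    then obtain A B where A: "A \<in> Pplus" "q = diag_act A p" and B: "B \<in> Pplus" "r = diag_act B q"
      by (auto simp: par_rel_def)
    obtain a b where ab: "A = mat2 1 a 0 1" "B = mat2 1 b 0 1"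
      using A(1) B(1) by (auto simp: Pplus_int)
    have "B ** A = mat2 1 (a + b) 0 1"
      unfolding ab by (rule mat2_eqI) (simp_all add: matmul2_nth)
    then have "B ** A \<in> Pplus"
      by (auto simp: Pplus_int)
    moreover have "r = diag_act (B ** A) p"
      using A B by (simp add: diag_act_mult)
    ultimately show "(p, r) \<in> par_rel"
      using pq qr by (auto simp: par_rel_def)
  qed
qed

lemma embed_complex_mult: "embed_complex (v * w) = embed_complex v ** embed_complex w"
  by (rule mat2_eqI) (simp_all add: embed_complex_def matmul2_nth algebra_simps)

lemma embed_complex_one: "embed_complex 1 = mat 1"
  by (rule mat2_eqI) (simp_all add: embed_complex_def mat_def)

lemma lat_relI:
  "p \<in> lat_space \<Longrightarrow> q \<in> lat_space \<Longrightarrow> A \<in> SL2Z \<Longrightarrow> w \<noteq> 0 \<Longrightarrow>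
     q = (fst (diag_act A p), snd (diag_act A p) ** embed_complex w) \<Longrightarrow> (p, q) \<in> lat_rel"
  by (auto simp: lat_rel_def)

lemma lat_rel_space: "(p, q) \<in> lat_rel \<Longrightarrow> p \<in> lat_space \<and> q \<in> lat_space"
  by (auto simp: lat_rel_def)

lemma equiv_lat_rel: "equiv lat_space lat_rel"
proof (rule equivI)
  show "lat_rel \<subseteq> lat_space \<times> lat_space"
    by (auto simp: lat_rel_def)
  have one: "mat 1 \<in> SL2Z"
    by (simp add: SL2Z_def)
  show "refl_on lat_space lat_rel"
    unfolding refl_on_def
  proof
    fix p assume "p \<in> lat_space"
    moreover have "p = (fst (diag_act (mat 1) p), snd (diag_act (mat 1) p) ** embed_complex 1)"
      by (simp add: diag_act_one embed_complex_one matrix_mul_rid)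
    moreover have "(1 :: complex) \<noteq> 0"
      by simp
    ultimately show "(p, p) \<in> lat_rel"
      using one by (intro lat_relI)
  qed
  show "sym lat_rel"
  proof (rule symI)
    fix p q assume pq: "(p, q) \<in> lat_rel"
    then obtain A w where A: "A \<in> SL2Z" "w \<noteq> 0"
      "q = (fst (diag_act A p), snd (diag_act A p) ** embed_complex w)"
      by (auto simp: lat_rel_def)
    define B where "B = mat2 (A $ 2 $ 2) (- A $ 1 $ 2) (- A $ 2 $ 1) (A $ 1 $ 1)"
    have dA: "det A = 1"
      using A(1) by (simp add: SL2Z_def)
    have "B \<in> SL2Z"
      using dA by (simp add: SL2Z_def B_def det_2 algebra_simps)
    moreover have "embed_complex w ** embed_complex (inverse w) = mat 1"
      using A(2) by (simp flip: embed_complex_mult add: embed_complex_one)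
    then have "diag_act B q = (fst p, snd p ** embed_complex w)"
      using diag_act_mult[of B A p] mat2_int_inverse[OF dA] A(3)
      by (simp add: B_def diag_act_one) (simp add: diag_act_def matrix_mul_assoc prod_eq_iff)
    then have "p = (fst (diag_act B q), snd (diag_act B q) ** embed_complex (inverse w))"
      using \<open>embed_complex w ** embed_complex (inverse w) = mat 1\<close>
      by (simp add: matrix_mul_rid flip: matrix_mul_assoc)
    moreover have "inverse w \<noteq> 0"
      using A(2) by simp
    ultimately show "(q, p) \<in> lat_rel"
      using lat_rel_space[OF pq] by (intro lat_relI) auto
  qed
  show "trans lat_rel"
  proof (rule transI)
    fix p q r assume pq: "(p, q) \<in> lat_rel" and qr: "(q, r) \<in> lat_rel"
    then obtain A v B w where A: "A \<in> SL2Z" "v \<noteq> 0"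
        "q = (fst (diag_act A p), snd (diag_act A p) ** embed_complex v)"
      and B: "B \<in> SL2Z" "w \<noteq> 0"
        "r = (fst (diag_act B q), snd (diag_act B q) ** embed_complex w)"
      by (auto simp: lat_rel_def)
    have "B ** A \<in> SL2Z"
      using A(1) B(1) by (simp add: SL2Z_def det_mul)
    moreover have "r = (fst (diag_act (B ** A) p), snd (diag_act (B ** A) p) ** embed_complex (v * w))"
      unfolding B(3) A(3) diag_act_mult
      by (simp add: diag_act_def embed_complex_mult matrix_mul_assoc)
    moreover have "v * w \<noteq> 0"
      using A(2) B(2) by simp
    ultimately show "(p, r) \<in> lat_rel"
      using lat_rel_space[OF pq] lat_rel_space[OF qr] by (intro lat_relI) auto
  qed
qed

abbreviation par_class :: "adelic_pair \<Rightarrow> adelic_pair set" where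
  "par_class p \<equiv> par_rel `` {p}"

abbreviation lat_class :: "adelic_pair \<Rightarrow> adelic_pair set" where
  "lat_class p \<equiv> lat_rel `` {p}"

text \<open>The topological spaces \<open>\<Pi>\<close> and \<open>\<Gamma>\(M\<^sub>2(zhat) \<times> GL\<^sub>2\<^sup>+(\<real>))/\<complex>\<^sup>\<times>\<close>.\<close>

definition par_top :: "adelic_pair set topology" where
  "par_top = quotient_top (top_of_set par_space) par_rel"

definition lat_top :: "adelic_pair set topology" where
  "lat_top = quotient_top (top_of_set lat_space) lat_rel"

text \<open>Since \<open>par_space \<subseteq> lat_space\<close> holds literally, the map induced by the inclusions sends a class
  \<open>c\<close> to the union of the classes in the target of all the elements of \<open>c\<close>, which is a single
  class exactly because the map is well defined.\<close>

definition theta :: "adelic_pair set \<Rightarrow> adelic_pair set" where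
  "theta c = lat_rel `` c"


section \<open>Complex structures\<close>

definition par_right_act :: "adelic_pair set \<Rightarrow> real ^ 2 ^ 2 \<Rightarrow> adelic_pair set" where
  "par_right_act c h = (\<lambda>(\<rho>, g). (\<rho>, g ** h)) ` c"

text \<open>The vector fields \<open>X\<close> and \<open>Y\<close> generating the right action.\<close>

definition par_X :: "(adelic_pair set \<Rightarrow> complex) \<Rightarrow> adelic_pair set \<Rightarrow> complex" where
  "par_X f c = vector_derivative (\<lambda>\<epsilon>. f (par_right_act c (mat2 1 \<epsilon> 0 1))) (at 0)"

definition par_Y :: "(adelic_pair set \<Rightarrow> complex) \<Rightarrow> adelic_pair set \<Rightarrow> complex" where
  "par_Y f c = vector_derivative (\<lambda>\<epsilon>. f (par_right_act c (mat2 (exp \<epsilon>) 0 0 1))) (at 0)"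

text \<open>Holomorphy on an open subset \<open>U\<close> of \<open>\<Pi>\<close>. The equation \<open>(X + iY) f = 0\<close> is imposed on
  functions that are (Frechet) differentiable in the real coordinates \<open>(x, y)\<close> of the archimedean
  factor; the mere existence of the two derivatives would not suffice. Here and in
  \<open>lat_holomorphic\<close> the non-archimedean component \<open>\<rho>\<close> is a parameter, in which nothing is required;
  continuity in all variables is part of \<open>holomorphic_map\<close>.\<close>

definition par_holomorphic :: "adelic_pair set set \<Rightarrow> (adelic_pair set \<Rightarrow> complex) \<Rightarrow> bool" where
  "par_holomorphic U f \<longleftrightarrow>
     (\<forall>\<rho>\<in>Pbar. \<forall>x y. 0 < y \<longrightarrow> par_class (\<rho>, mat2 y x 0 1) \<in> U \<longrightarrow>
        (\<lambda>(x, y). f (par_class (\<rho>, mat2 y x 0 1))) differentiable (at (x, y)) \<and>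
        par_X f (par_class (\<rho>, mat2 y x 0 1)) + \<i> * par_Y f (par_class (\<rho>, mat2 y x 0 1)) = 0)"

definition tau :: "real ^ 2 ^ 2 \<Rightarrow> complex" where
  "tau \<alpha> = moebius (of_real (\<alpha> $ 1 $ 1)) (of_real (\<alpha> $ 1 $ 2))
                   (of_real (\<alpha> $ 2 $ 1)) (of_real (\<alpha> $ 2 $ 2)) \<i>"

text \<open>Holomorphy on an open subset \<open>V\<close> of the target: for fixed \<open>\<rho>\<close>, the function is a holomorphic
  function of the local parameter \<open>z = \<alpha>(i)\<close> in the upper half-plane.\<close>

definition lat_holomorphic :: "adelic_pair set set \<Rightarrow> (adelic_pair set \<Rightarrow> complex) \<Rightarrow> bool" where
  "lat_holomorphic V f \<longleftrightarrow>
     (\<forall>\<rho>. \<exists>h. h holomorphic_on {tau \<alpha> | \<alpha>. \<alpha> \<in> GL2plus \<and> lat_class (\<rho>, \<alpha>) \<in> V} \<and>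
        (\<forall>\<alpha>\<in>GL2plus. lat_class (\<rho>, \<alpha>) \<in> V \<longrightarrow> f (lat_class (\<rho>, \<alpha>)) = h (tau \<alpha>)))"

text \<open>A complex structure being given by the holomorphic functions on open subsets, a map is
  holomorphic if it is continuous and pulls holomorphic functions back to holomorphic functions.\<close>

definition holomorphic_map ::
  "'a topology \<Rightarrow> ('a set \<Rightarrow> ('a \<Rightarrow> complex) \<Rightarrow> bool) \<Rightarrow>
   'b topology \<Rightarrow> ('b set \<Rightarrow> ('b \<Rightarrow> complex) \<Rightarrow> bool) \<Rightarrow> ('a \<Rightarrow> 'b) \<Rightarrow> bool" where
  "holomorphic_map S HS T HT \<phi> \<longleftrightarrow>
     continuous_map S T \<phi> \<and>
     (\<forall>V f. openin T V \<longrightarrow> HT V f \<longrightarrow> HS {c \<in> topspace S. \<phi> c \<in> V} (f \<circ> \<phi>))"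

end

theory Submission
  imports Defs
begin

text \<open>The inclusions induce a well-defined map because \<open>P\<^sup>+(\<int>)\<close> consists of upper unipotent matrices
  and so lies in \<open>\<Gamma>\<close>: equivalent parabolic lattices are equivalent as lattices, with trivial
  rescaling (\<open>par_rel_subset_lat_rel\<close>). Being induced by a continuous map, it is continuous for the
  quotient topologies (\<open>continuous_map_quotient_top\<close>).

  For holomorphy the point is that \<open>P\<^sup>+(\<real>)\<close> is the image of a section of \<open>GL\<^sub>2\<^sup>+(\<real>) \<rightarrow> \<H>\<close>: the
  matrix with rows \<open>(y, x)\<close> and \<open>(0, 1)\<close> sends \<open>\<i>\<close> to \<open>z = x + \<i>y\<close>. A holomorphic function on the target thus pulls
  back, for each fixed \<open>\<rho>\<close>, to \<open>h (x + \<i>y)\<close> with \<open>h\<close> holomorphic on an open set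
  (\<open>lat_holomorphic_on_section\<close>). Right multiplication by the two
  one-parameter groups moves \<open>z\<close> with velocities \<open>y\<close> and \<open>\<i>y\<close>, so that \<open>X = y h'(z)\<close>,
  \<open>Y = \<i>y h'(z)\<close> and \<open>X + \<i>Y = 0\<close>: the equation is Cauchy--Riemann in the coordinate \<open>z\<close>
  (\<open>par_holomorphicI\<close>).\<close>


section \<open>Maps between quotient spaces\<close>

lemma quotient_member:
  assumes "equiv A r" "C \<in> A // r" "x \<in> C"
  shows "x \<in> A" "r `` {x} = C"
proof -
  obtain a where a: "a \<in> A" "C = r `` {a}"
    using assms(2) by (rule quotientE)
  with assms(3) have "(a, x) \<in> r"
    by simp
  then show "x \<in> A" "r `` {x} = C"
    using a(2) equiv_class_eq_iff[OF assms(1), of a x] by auto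
qed

lemma topspace_quotient_top:
  assumes "equiv (topspace T) r"
  shows "topspace (quotient_top T r) = topspace T // r"
proof (rule antisym)
  show "topspace (quotient_top T r) \<subseteq> topspace T // r"
    using openin_quotient_top[OF assms] openin_topspace by blast
  have "openin (quotient_top T r) (topspace T // r)"
    by (simp add: openin_quotient_top[OF assms] Union_quotient[OF assms])
  then show "topspace T // r \<subseteq> topspace (quotient_top T r)"
    by (rule openin_subset)
qed

lemma openin_vimage_quotient_class:
  assumes "equiv (topspace T) r" and "openin (quotient_top T r) V"
  shows "openin T {x \<in> topspace T. r `` {x} \<in> V}"
proof -
  have V: "V \<subseteq> topspace T // r" "openin T (\<Union>V)"
    using assms(2) openin_quotient_top[OF assms(1)] by auto
  have "{x \<in> topspace T. r `` {x} \<in> V} = \<Union>V"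
  proof (intro set_eqI iffI)
    fix x assume "x \<in> {x \<in> topspace T. r `` {x} \<in> V}"
    then show "x \<in> \<Union>V"
      using equiv_class_self[OF assms(1)] by blast
  next
    fix x assume "x \<in> \<Union>V"
    then obtain C where C: "C \<in> V" "x \<in> C"
      by blast
    then have "x \<in> topspace T" "r `` {x} = C"
      using V quotient_member[OF assms(1), of C x] by blast+
    then show "x \<in> {x \<in> topspace T. r `` {x} \<in> V}"
      using C by simp
  qed
  with V show ?thesis by simp
qed

text \<open>The open sets of a quotient are the sets of classes with open union, and the union of the classes
  that \<open>\<phi>\<close> sends into \<open>V\<close> is the preimage of \<open>\<Union>V\<close> under \<open>f\<close>.\<close>

lemma continuous_map_quotient_top:
  assumes S: "equiv (topspace S) r" and T: "equiv (topspace T) s"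
    and f: "continuous_map S T f"
    and \<phi>: "\<And>x. x \<in> topspace S \<Longrightarrow> \<phi> (r `` {x}) = s `` {f x}"
  shows "continuous_map (quotient_top S r) (quotient_top T s) \<phi>"
  unfolding continuous_map_def topspace_quotient_top[OF S] topspace_quotient_top[OF T]
proof (intro conjI allI impI)
  have fS: "f x \<in> topspace T" if "x \<in> topspace S" for x
    using f that by (auto simp: continuous_map_def)
  show "\<phi> \<in> topspace S // r \<rightarrow> topspace T // s"
    using \<phi> fS by (auto elim!: quotientE intro!: quotientI)
  fix V assume V: "openin (quotient_top T s) V"
  let ?U = "{c \<in> topspace S // r. \<phi> c \<in> V}"
  have "\<Union>?U = {x \<in> topspace S. f x \<in> {y \<in> topspace T. s `` {y} \<in> V}}"
  proof (intro set_eqI iffI)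
    fix x assume "x \<in> \<Union>?U"
    then obtain c where c: "c \<in> topspace S // r" "\<phi> c \<in> V" "x \<in> c"
      by blast
    then have x: "x \<in> topspace S" "r `` {x} = c"
      using quotient_member[OF S, of c x] by blast+
    then show "x \<in> {x \<in> topspace S. f x \<in> {y \<in> topspace T. s `` {y} \<in> V}}"
      using c \<phi>[of x] fS[of x] by simp
  next
    fix x assume "x \<in> {x \<in> topspace S. f x \<in> {y \<in> topspace T. s `` {y} \<in> V}}"
    then show "x \<in> \<Union>?U"
      using \<phi>[of x] equiv_class_self[OF S, of x] by (auto intro!: bexI[of _ "r `` {x}"] quotientI)
  qed
  moreover have "openin S {x \<in> topspace S. f x \<in> {y \<in> topspace T. s `` {y} \<in> V}}"
    using f openin_vimage_quotient_class[OF T V] by (rule openin_continuous_map_preimage)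
  ultimately show "openin (quotient_top S r) ?U"
    by (auto simp: openin_quotient_top[OF S])
qed


section \<open>From parabolic lattices to lattices\<close>

lemma Pplus_subset_GL2plus: "Pplus \<subseteq> GL2plus"
  by (auto simp: Pplus_real GL2plus_def det_2)

lemma par_space_subset_lat_space: "par_space \<subseteq> lat_space"
  using Pplus_subset_GL2plus by (auto simp: par_space_def lat_space_def)

lemma par_rel_subset_lat_rel: "par_rel \<subseteq> lat_rel"
proof
  fix pq assume "pq \<in> par_rel"
  then obtain p q A where pq: "pq = (p, q)" "p \<in> par_space" "q \<in> par_space"
    and A: "A \<in> Pplus" "q = diag_act A p"
    by (auto simp: par_rel_def)
  have "A \<in> SL2Z"
    using A(1) by (auto simp: Pplus_int SL2Z_def det_2)
  moreover have "q = (fst (diag_act A p), snd (diag_act A p) ** embed_complex 1)"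
    by (simp add: A(2) embed_complex_one matrix_mul_rid)
  ultimately show "pq \<in> lat_rel"
    unfolding pq(1) using pq(2,3) par_space_subset_lat_space
    by (intro lat_relI[where A = A and w = 1]) auto
qed

lemma theta_par_class:
  assumes "p \<in> par_space"
  shows "theta (par_class p) = lat_class p"
proof -
  have "lat_class q = lat_class p" if "q \<in> par_class p" for q
    using that par_rel_subset_lat_rel equiv_class_eq[OF equiv_lat_rel, of p q] by auto
  moreover have "p \<in> par_class p"
    using assms by (rule equiv_class_self[OF equiv_par_rel])
  ultimately show ?thesis
    unfolding theta_def by blast
qed

lemma continuous_map_theta: "continuous_map par_top lat_top theta"
  unfolding par_top_def lat_top_def
proof (rule continuous_map_quotient_top[where f = id])
  show "continuous_map (top_of_set par_space) (top_of_set lat_space) id"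
    using par_space_subset_lat_space by (auto simp: continuous_map_in_subtopology id_def)
qed (auto simp: equiv_par_rel equiv_lat_rel theta_par_class)


section \<open>The section of the upper half-plane\<close>

lemma mat2_in_Pplus: "0 < y \<Longrightarrow> mat2 y x 0 1 \<in> (Pplus :: (real ^ 2 ^ 2) set)"
  unfolding Pplus_real by blast

lemma tau_mat2: "tau (mat2 y x 0 1) = Complex x y"
  by (simp add: tau_def moebius_def complex_eq_iff)

lemma continuous_on_mat2 [continuous_intros]:
  fixes a b c d :: "'a::topological_space \<Rightarrow> 'b::{zero, topological_space}"
  assumes "continuous_on S a" "continuous_on S b" "continuous_on S c" "continuous_on S d"
  shows "continuous_on S (\<lambda>x. mat2 (a x) (b x) (c x) (d x))"
proof -
  let ?M = "\<lambda>x. (\<chi> i j. if i = 1 then if j = 1 then a x else b x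
    else if j = 1 then c x else d x) :: 'b ^ 2 ^ 2"
  have M: "(\<lambda>x. mat2 (a x) (b x) (c x) (d x)) = ?M"
    by (intro ext mat2_eqI) simp_all
  show ?thesis
    unfolding M
  proof (intro continuous_on_vec_lambda)
    fix i j :: 2
    show "continuous_on S (\<lambda>x. if i = 1 then if j = 1 then a x else b x else if j = 1 then c x else d x)"
      using assms by (cases "i = 1"; cases "j = 1") simp_all
  qed
qed

text \<open>The domain of \<open>h\<close> in \<open>lat_holomorphic\<close> is described as an image under \<open>tau\<close>, where openness is
  not evident. The points \<open>D\<close> that the section sends into \<open>V\<close> lie in that image and form an open
  set, as a preimage under a continuous map, so \<open>h\<close> has complex derivatives at all of them.\<close>

lemma lat_holomorphic_on_section:
  fixes \<rho> :: "zhat ^ 2 ^ 2"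
  assumes V: "openin lat_top V" and f: "lat_holomorphic V f"
  defines "D \<equiv> {z. 0 < Im z \<and> lat_class (\<rho>, mat2 (Im z) (Re z) 0 1) \<in> V}"
  obtains h where "open D" "h holomorphic_on D"
    "\<And>z. z \<in> D \<Longrightarrow> f (lat_class (\<rho>, mat2 (Im z) (Re z) 0 1)) = h z"
proof -
  let ?s = "\<lambda>z. (\<rho>, mat2 (Im z) (Re z) 0 1)"
  have s: "?s z \<in> lat_space" if "0 < Im z" for z
    using mat2_in_Pplus[OF that] Pplus_subset_GL2plus by (auto simp: lat_space_def)
  obtain h where h: "h holomorphic_on {tau \<alpha> | \<alpha>. \<alpha> \<in> GL2plus \<and> lat_class (\<rho>, \<alpha>) \<in> V}"
    and fh: "\<And>\<alpha>. \<alpha> \<in> GL2plus \<Longrightarrow> lat_class (\<rho>, \<alpha>) \<in> V \<Longrightarrow> f (lat_class (\<rho>, \<alpha>)) = h (tau \<alpha>)"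
    using f unfolding lat_holomorphic_def by blast
  have "openin (top_of_set lat_space) {p \<in> lat_space. lat_class p \<in> V}"
    using openin_vimage_quotient_class[of "top_of_set lat_space" lat_rel V] V equiv_lat_rel
    by (simp add: lat_top_def)
  then obtain W where W: "open W" "{p \<in> lat_space. lat_class p \<in> V} = lat_space \<inter> W"
    by (auto simp: openin_open)
  have "D = {z. 0 < Im z} \<inter> ?s -` W"
    using W(2) s unfolding D_def by blast
  moreover have "continuous_on UNIV ?s"
    by (intro continuous_intros)
  ultimately have "open D"
    using W(1) by (auto intro!: open_Int open_vimage simp: open_halfspace_Im_gt)
  moreover have tau_s: "tau (mat2 (Im z) (Re z) 0 1) = z" for z
    by (simp add: tau_mat2)
  have G: "mat2 (Im z) (Re z) 0 1 \<in> GL2plus" "lat_class (?s z) \<in> V" if "z \<in> D" for z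
    using that s[of z] by (auto simp: D_def lat_space_def)
  have "D \<subseteq> {tau \<alpha> | \<alpha>. \<alpha> \<in> GL2plus \<and> lat_class (\<rho>, \<alpha>) \<in> V}"
    using G tau_s by (smt (verit) mem_Collect_eq subsetI)
  with h have "h holomorphic_on D"
    by (rule holomorphic_on_subset)
  moreover have "f (lat_class (?s z)) = h z" if "z \<in> D" for z
    using fh[OF G[OF that]] tau_s by simp
  ultimately show ?thesis by (rule that)
qed


section \<open>The complex structure of the right action\<close>

lemma mat2_Pplus_mult:
  "mat2 a b 0 1 ** mat2 c d 0 1 = mat2 (a * c) (a * d + b) 0 (1 :: real)"
  by (rule mat2_eqI) (simp_all add: matmul2_nth)

text \<open>Left multiplication by \<open>P\<^sup>+(\<int>)\<close> preserves \<open>par_space\<close>, so a class is a full orbit of that group;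
  right multiplication commutes with the left action and therefore carries orbits to orbits.\<close>

lemma par_right_act_par_class:
  assumes "\<rho> \<in> Pbar" "g \<in> Pplus" "h \<in> Pplus"
  shows "par_right_act (par_class (\<rho>, g)) h = par_class (\<rho>, g ** h)"
proof -
  have closed: "u ** v \<in> Pplus" if "u \<in> Pplus" "v \<in> Pplus" for u v :: "real ^ 2 ^ 2"
    using that unfolding Pplus_real by (metis mat2_Pplus_mult mult_pos_pos)
  have P: "map_matrix of_int A ** \<rho> \<in> Pbar \<and> map_matrix of_int A ** u \<in> Pplus"
    if A: "A \<in> Pplus" and u: "u \<in> Pplus" for A :: "int ^ 2 ^ 2" and u :: "real ^ 2 ^ 2"
  proof
    obtain n where n: "A = mat2 1 n 0 1"
      using A by (auto simp: Pplus_int)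
    obtain a b where ab: "\<rho> = mat2 a b 0 1"
      using assms(1) by (auto simp: Pbar_def)
    have "map_matrix of_int A ** \<rho> = mat2 a (b + of_int n) 0 1"
      unfolding n ab by (rule mat2_eqI) (simp_all add: matmul2_nth map_matrix_nth)
    then show "map_matrix of_int A ** \<rho> \<in> Pbar"
      by (auto simp: Pbar_def)
    have "map_matrix of_int A = mat2 1 (of_int n) 0 (1 :: real)"
      unfolding n by (rule mat2_eqI) (simp_all add: map_matrix_nth)
    then show "map_matrix of_int A ** u \<in> Pplus"
      using closed[OF mat2_in_Pplus u, of 1 "of_int n"] by simp
  qed
  have orbit: "par_class (\<rho>, u) = (\<lambda>A. diag_act A (\<rho>, u)) ` Pplus" if "u \<in> Pplus" for u
    using that assms(1) P[OF _ that] by (auto simp: par_rel_def par_space_def diag_act_def)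
  show ?thesis
    unfolding par_right_act_def orbit[OF assms(2)] orbit[OF closed[OF assms(2,3)]]
    by (simp add: image_image diag_act_def matrix_mul_assoc)
qed

text \<open>The curves \<open>\<epsilon> \<mapsto> x + y\<epsilon> + \<i>y\<close> and \<open>\<epsilon> \<mapsto> x + \<i>y e\<^sup>\<epsilon>\<close> traced by the two one-parameter
  groups have velocities \<open>y\<close> and \<open>\<i>y\<close> at \<open>\<epsilon> = 0\<close>; by the chain rule \<open>X\<close> and \<open>Y\<close> multiply the complex
  derivative by these numbers, and \<open>y + \<i> \<cdot> \<i>y = 0\<close>.\<close>

lemma par_holomorphicI:
  assumes loc: "\<And>\<rho> x y. \<rho> \<in> Pbar \<Longrightarrow> 0 < y \<Longrightarrow> par_class (\<rho>, mat2 y x 0 1) \<in> U \<Longrightarrow>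
      \<exists>D h. open D \<and> Complex x y \<in> D \<and> h holomorphic_on D \<and>
        (\<forall>z\<in>D. f (par_class (\<rho>, mat2 (Im z) (Re z) 0 1)) = h z)"
  shows "par_holomorphic U f"
  unfolding par_holomorphic_def
proof (intro ballI allI impI)
  fix \<rho> :: "zhat ^ 2 ^ 2" and x y :: real
  assume \<rho>: "\<rho> \<in> Pbar" and y: "0 < y" and U: "par_class (\<rho>, mat2 y x 0 1) \<in> U"
  let ?F = "\<lambda>z. f (par_class (\<rho>, mat2 (Im z) (Re z) 0 1))"
  obtain D h where D: "open D" "Complex x y \<in> D" and hol: "h holomorphic_on D"
    and Fh: "\<And>z. z \<in> D \<Longrightarrow> ?F z = h z"
    using loc[OF \<rho> y U] by blast
  obtain h' where "(h has_field_derivative h') (at (Complex x y))"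
    using hol D by (metis holomorphic_derivI)
  then have F': "(?F has_field_derivative h') (at (Complex x y))"
    by (rule has_field_derivative_transform_within_open[OF _ D]) (simp add: Fh)
  have "((\<lambda>(x, y). Complex x y) has_derivative (\<lambda>(x, y). Complex x y)) (at (x, y))"
    unfolding case_prod_beta Complex_eq
    by (auto intro!: derivative_eq_intros)
  then have "(?F \<circ> (\<lambda>(x, y). Complex x y) has_derivative (*) h' \<circ> (\<lambda>(x, y). Complex x y)) (at (x, y))"
    using F' by (intro diff_chain_at) (simp_all add: has_field_derivative_def)
  then have diff: "(\<lambda>(x, y). f (par_class (\<rho>, mat2 y x 0 1))) differentiable (at (x, y))"
    unfolding differentiable_def by (intro exI) (simp add: o_def case_prod_unfold)
  have X: "par_X f (par_class (\<rho>, mat2 y x 0 1)) = y * h'"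
  proof -
    have "((\<lambda>\<epsilon>. Complex (y * \<epsilon> + x) y) has_vector_derivative of_real y) (at 0)"
      unfolding Complex_eq by (auto intro!: derivative_eq_intros simp: scaleR_conv_of_real has_vector_derivative_def)
    then have "(?F \<circ> (\<lambda>\<epsilon>. Complex (y * \<epsilon> + x) y) has_vector_derivative of_real y * h') (at 0)"
      using F' by (intro field_vector_diff_chain_at) simp_all
    moreover have "par_right_act (par_class (\<rho>, mat2 y x 0 1)) (mat2 1 \<epsilon> 0 1)
        = par_class (\<rho>, mat2 y (y * \<epsilon> + x) 0 1)" for \<epsilon>
      using \<rho> y by (simp add: par_right_act_par_class mat2_in_Pplus mat2_Pplus_mult)
    ultimately show ?thesis
      unfolding par_X_def by (simp add: o_def vector_derivative_at)
  qed
  have Y: "par_Y f (par_class (\<rho>, mat2 y x 0 1)) = \<i> * y * h'"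
  proof -
    have "((\<lambda>\<epsilon>. Complex x (y * exp \<epsilon>)) has_vector_derivative \<i> * of_real y) (at 0)"
      unfolding Complex_eq by (auto intro!: derivative_eq_intros simp: scaleR_conv_of_real has_vector_derivative_def)
    then have "(?F \<circ> (\<lambda>\<epsilon>. Complex x (y * exp \<epsilon>)) has_vector_derivative \<i> * of_real y * h') (at 0)"
      using F' by (intro field_vector_diff_chain_at) simp_all
    moreover have "par_right_act (par_class (\<rho>, mat2 y x 0 1)) (mat2 (exp \<epsilon>) 0 0 1)
        = par_class (\<rho>, mat2 (y * exp \<epsilon>) x 0 1)" for \<epsilon>
      using \<rho> y by (simp add: par_right_act_par_class mat2_in_Pplus mat2_Pplus_mult)
    ultimately show ?thesis
      unfolding par_Y_def by (simp add: o_def vector_derivative_at)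
  qed
  show "(\<lambda>(x, y). f (par_class (\<rho>, mat2 y x 0 1))) differentiable (at (x, y)) \<and>
      par_X f (par_class (\<rho>, mat2 y x 0 1)) + \<i> * par_Y f (par_class (\<rho>, mat2 y x 0 1)) = 0"
    using diff by (simp add: X Y flip: mult.assoc)
qed

theorem proposition6p4:
  shows "(\<forall>\<rho>\<in>Pbar. \<forall>g\<in>Pplus. theta (par_class (\<rho>, g)) = lat_class (\<rho>, g)) \<and>
    holomorphic_map par_top par_holomorphic lat_top lat_holomorphic theta"
  unfolding holomorphic_map_def
proof (intro conjI allI impI ballI)
  show "theta (par_class (\<rho>, g)) = lat_class (\<rho>, g)" if "\<rho> \<in> Pbar" "g \<in> Pplus" for \<rho> g
    using that by (simp add: theta_par_class par_space_def)
  show "continuous_map par_top lat_top theta"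
    by (rule continuous_map_theta)
  fix V f assume V: "openin lat_top V" and f: "lat_holomorphic V f"
  show "par_holomorphic {c \<in> topspace par_top. theta c \<in> V} (f \<circ> theta)"
  proof (rule par_holomorphicI)
    fix \<rho> :: "zhat ^ 2 ^ 2" and x y :: real
    assume \<rho>: "\<rho> \<in> Pbar" and y: "0 < y"
      and U: "par_class (\<rho>, mat2 y x 0 1) \<in> {c \<in> topspace par_top. theta c \<in> V}"
    let ?D = "{z. 0 < Im z \<and> lat_class (\<rho>, mat2 (Im z) (Re z) 0 1) \<in> V}"
    have th: "theta (par_class (\<rho>, mat2 v u 0 1)) = lat_class (\<rho>, mat2 v u 0 1)" if "0 < v" for u v
      using \<rho> mat2_in_Pplus[OF that] by (simp add: theta_par_class par_space_def)
    obtain h where "open ?D" "h holomorphic_on ?D"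
      and "\<And>z. z \<in> ?D \<Longrightarrow> f (lat_class (\<rho>, mat2 (Im z) (Re z) 0 1)) = h z"
      using lat_holomorphic_on_section[OF V f] by blast
    moreover have "Complex x y \<in> ?D"
      using U y th[OF y, of x] by simp
    ultimately show "\<exists>D h. open D \<and> Complex x y \<in> D \<and> h holomorphic_on D \<and>
        (\<forall>z\<in>D. (f \<circ> theta) (par_class (\<rho>, mat2 (Im z) (Re z) 0 1)) = h z)"
      using th by (intro exI[of _ ?D] exI[of _ h]) auto
  qed
qed

end
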